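(* Let $x=(x_1,x_2,x_3)$, $y=(y_1,y_2,y_3)$ be real variables, and, with indices taken cyclically modulo $3$ (so that $x_4=x_1$ and $y_4=y_1$), let $$f_{sep}(x,y)=\sum_{i=1}^3\left(x_i^4+y_i^4\right),$$ $$B^*(x,y)=\sum_{i=1}^3\Big(2x_i^2y_i^2-2x_i^2y_iy_{i+1}-2x_ix_{i+1}y_i^2+3x_i^2y_{i+1}^2+3x_{i+1}^2y_i^2\Big).$$ Then the polynomial $f(x,y)=f_{sep}(x,y)+0.1\,B^*(x,y)$ is not sos-convex.
   Context: A real polynomial is a sum of squares (sos) if it is a finite sum of squares of real polynomials. A polynomial $f$ in $N$ real variables $w=(w_1,\dots,w_N)$ with Hessian matrix $H_f(w)$ is called sos-convex if its Hessian admits a sum-of-squares factorization, i.e. $H_f(w)=M(w)^TM(w)$ for some (not necessarily square) matrix $M(w)$ with real polynomial entries; equivalently, the polynomial $z^TH_f(w)z$ in the variables $(w,z)$, $z=(z_1,\dots,z_N)$, is sos. Here $N=6$ and $w=(x,y)$. *)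

theory Defs
  imports "HOL-Analysis.Analysis"
begin

text \<open>
  Real polynomials in the variables \<open>w $ i\<close> are represented by the polynomial functions they induce
  (\<^const>\<open>real_polynomial_function\<close>); over the infinite field of reals this loses no information.
\<close>

definition partial_deriv :: "'n::finite \<Rightarrow> (real^'n \<Rightarrow> real) \<Rightarrow> real^'n \<Rightarrow> real" where
  "partial_deriv i f w = deriv (\<lambda>t. f (w + t *\<^sub>R axis i 1)) 0"

definition hessian :: "(real^'n::finite \<Rightarrow> real) \<Rightarrow> real^'n \<Rightarrow> real^'n^'n" where
  "hessian f w = (\<chi> i j. partial_deriv i (partial_deriv j f) w)"

text \<open>
  \<open>M r j\<close> is the entry in row \<open>r < m\<close> and column \<open>j\<close> of a polynomial matrix \<open>M\<close>, and the equation
  says \<open>H\<^sub>f(w) = M(w)\<^sup>T M(w)\<close> entrywise. The rows are indexed by natural numbers because their number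
  is existentially quantified. The notion is meant for polynomial \<open>f\<close>.
\<close>

definition sos_convex :: "(real^'n::finite \<Rightarrow> real) \<Rightarrow> bool" where
  "sos_convex f \<longleftrightarrow>
    (\<exists>(m::nat) (M :: nat \<Rightarrow> 'n \<Rightarrow> real^'n \<Rightarrow> real).
      (\<forall>r<m. \<forall>j. real_polynomial_function (M r j)) \<and>
      (\<forall>w i j. hessian f w $ i $ j = (\<Sum>r<m. M r i w * M r j w)))"

text \<open>
  The index type \<open>3\<close> consists of the residues modulo 3, so \<open>i + 1\<close> below is the cyclic successor.
\<close>

definition f_sep :: "real^3 \<Rightarrow> real^3 \<Rightarrow> real" where
  "f_sep x y = (\<Sum>i\<in>UNIV. (x $ i)^4 + (y $ i)^4)"

definition B_star :: "real^3 \<Rightarrow> real^3 \<Rightarrow> real" where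
  "B_star x y = (\<Sum>i\<in>UNIV.
      2 * (x $ i)^2 * (y $ i)^2
    - 2 * (x $ i)^2 * (y $ i) * (y $ (i + 1))
    - 2 * (x $ i) * (x $ (i + 1)) * (y $ i)^2
    + 3 * (x $ i)^2 * (y $ (i + 1))^2
    + 3 * (x $ (i + 1))^2 * (y $ i)^2)"

text \<open>
  A point \<open>w = (x, y)\<close> of the 6-dimensional space has \<open>x\<close>-coordinates \<open>w $ Inl i\<close> and
  \<open>y\<close>-coordinates \<open>w $ Inr i\<close>.
\<close>

definition x_part :: "real^(3 + 3) \<Rightarrow> real^3" where
  "x_part w = (\<chi> i. w $ Inl i)"

definition y_part :: "real^(3 + 3) \<Rightarrow> real^3" where
  "y_part w = (\<chi> i. w $ Inr i)"

definition f_poly :: "real^(3 + 3) \<Rightarrow> real" where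
  "f_poly w = f_sep (x_part w) (y_part w) + 0.1 * B_star (x_part w) (y_part w)"

lemma real_polynomial_function_f_poly: "real_polynomial_function f_poly"
proof -
  have coord: "real_polynomial_function (\<lambda>w::real^(3 + 3). w $ i)" for i
    by (intro real_polynomial_function.intros(1) bounded_linear_vec_nth)
  show ?thesis
    unfolding f_poly_def [abs_def] f_sep_def B_star_def x_part_def y_part_def vec_lambda_beta
    by (intro real_polynomial_function.intros(2-) real_polynomial_function_sum
        real_polynomial_function_diff real_polynomial_function_power coord finite)
qed

end

theory Submission
  imports Defs
begin

text \<open>
  Write \<open>f\<close> for the polynomial and \<open>b\<close> for the symmetrized coefficients of \<open>B\<^sup>*\<close>, so that
  \<open>B\<^sup>*(x,y) = \<Sum> b i j k l x\<^sub>i x\<^sub>j y\<^sub>k y\<^sub>l\<close>. Suppose that \<open>H\<^sub>f = M\<^sup>T M\<close>. The Hessian is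
  homogeneous of degree 2, so \<open>M\<close> may be replaced by its linear part at the origin
  (\<open>sos_convex_linear_factor\<close>). Each column of \<open>M\<close> is then a linear map from points to
  vectors. Let \<open>P\<^sub>i\<^sub>k\<close> be the coefficient vector of \<open>y\<^sub>k\<close> in the column belonging to \<open>x\<^sub>i\<close>, and
  \<open>Q\<^sub>i\<^sub>k\<close> the coefficient vector of \<open>x\<^sub>i\<close> in the column belonging to \<open>y\<^sub>k\<close>.

  The obstruction is a rigidity of these vectors. The separable part contributes nothing to
  \<open>\<partial>\<^sup>2f/\<partial>x\<^sub>i\<^sup>2\<close> at the \<open>j\<close>-th \<open>x\<close>-axis for \<open>j \<noteq> i\<close>, and neither does \<open>B\<^sup>*\<close>; so the column of
  \<open>x\<^sub>i\<close> does not contain \<open>x\<^sub>j\<close>, and likewise for \<open>y\<close>. Comparing coefficients in the mixed block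
  of \<open>H\<^sub>f\<close> therefore determines every inner product \<open>P\<^sub>i\<^sub>l \<bullet> Q\<^sub>j\<^sub>k = 4 c b i j k l\<close> with
  \<open>(i,l) \<noteq> (j,k)\<close>, where \<open>c\<close> is the factor in front of \<open>B\<^sup>*\<close>. The pure blocks give
  \<open>P\<^sub>i\<^sub>k \<bullet> P\<^sub>j\<^sub>l + P\<^sub>i\<^sub>l \<bullet> P\<^sub>j\<^sub>k = 4 c b i j k l\<close> and the same for \<open>Q\<close>. Thus
  \<open>P\<^sub>i\<^sub>i \<bullet> Q\<^sub>i\<^sub>,\<^sub>i\<^sub>+\<^sub>1 = -4 c\<close> is twice \<open>P\<^sub>i\<^sub>i \<bullet> P\<^sub>i\<^sub>,\<^sub>i\<^sub>+\<^sub>1 = -2 c\<close>, and mixed products of this size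
  are incompatible with a positive semidefinite Gram matrix.

  Indeed, put \<open>g\<^sub>i = 2 S\<^sub>i\<^sub>i + S\<^sub>i\<^sub>,\<^sub>i\<^sub>+\<^sub>1 + S\<^sub>i\<^sub>+\<^sub>1\<^sub>,\<^sub>i\<close> for \<open>S = P + Q\<close> and
  \<open>h\<^sub>i = 2 D\<^sub>i\<^sub>i - D\<^sub>i\<^sub>,\<^sub>i\<^sub>+\<^sub>1 - D\<^sub>i\<^sub>+\<^sub>1\<^sub>,\<^sub>i\<close> for \<open>D = P - Q\<close>. The nonnegative number
  \<open>5 \<Sum>\<bar>g\<^sub>i\<bar>\<^sup>2 + 3 \<bar>\<Sum>g\<^sub>i\<bar>\<^sup>2 + 7 \<Sum>\<bar>h\<^sub>i\<bar>\<^sup>2 + \<bar>\<Sum>h\<^sub>i\<bar>\<^sup>2\<close>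
  involves only the inner products just determined (\<open>certificate_identity\<close>) and evaluates to
  \<open>-384 c\<close> (\<open>no_gram_vectors\<close>). So no such vectors exist for \<open>c > 0\<close>, in particular not for
  \<open>c = 1/10\<close>.
\<close>

section \<open>Reduction to linear factors\<close>

text \<open>
  The quotients \<open>M(s w)/s\<close> satisfy the factorization for every \<open>s \<noteq> 0\<close>, because both sides scale
  by \<open>s\<^sup>2\<close>. Since \<open>M\<close> vanishes where the Hessian does, they tend to the derivative of \<open>M\<close> at \<open>0\<close>
  as \<open>s\<close> tends to \<open>0\<close>, and the factorization survives in the limit.
\<close>

lemma sos_convex_linear_factor:
  fixes f :: "real^'n::finite \<Rightarrow> real"
  assumes "sos_convex f" and hom: "\<And>s w. hessian f (s *\<^sub>R w) = s\<^sup>2 *\<^sub>R hessian f w"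
  obtains m N where "\<And>r i. r < (m::nat) \<Longrightarrow> linear (N r i)"
    "\<And>w i j. hessian f w $ i $ j = (\<Sum>r<m. N r i w * N r j w)"
proof -
  obtain m :: nat and M where poly: "\<And>r i. r < m \<Longrightarrow> real_polynomial_function (M r i)"
    and fac: "\<And>w i j. hessian f w $ i $ j = (\<Sum>r<m. M r i w * M r j w)"
    using assms(1) unfolding sos_convex_def by blast
  define N where "N r i = frechet_derivative (M r i) (at 0)" for r i
  have deriv: "(M r i has_derivative N r i) (at 0)" if "r < m" for r i
    unfolding N_def frechet_derivative_works [symmetric]
    using poly [OF that] by (rule differentiable_at_real_polynomial_function)
  have zero: "M r i 0 = 0" if "r < m" for r i
  proof -
    have "hessian f 0 $ i $ i = 0"
      using hom [of 0 0] by simp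
    then have "(\<Sum>r<m. M r i 0 * M r i 0) = 0"
      by (simp add: fac)
    then show ?thesis
      using that by (subst (asm) sum_nonneg_eq_0_iff) auto
  qed
  have quotient: "((\<lambda>s. M r i (s *\<^sub>R w) / s) \<longlongrightarrow> N r i w) (at 0)" if "r < m" for r i w
  proof -
    have "((\<lambda>s::real. s *\<^sub>R w) has_derivative (\<lambda>s. s *\<^sub>R w)) (at 0)"
      by (auto intro!: derivative_eq_intros)
    from has_derivative_compose [OF this, of "M r i" "N r i"]
    have "((\<lambda>s. M r i (s *\<^sub>R w)) has_derivative (\<lambda>s. N r i (s *\<^sub>R w))) (at 0)"
      using deriv [OF that] by simp
    moreover have "(\<lambda>s. N r i (s *\<^sub>R w)) = (*) (N r i w)"
      using has_derivative_linear [OF deriv [OF that]] by (auto simp: linear_cmul)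
    ultimately have "((\<lambda>s. M r i (s *\<^sub>R w)) has_real_derivative N r i w) (at 0)"
      by (simp add: has_field_derivative_def)
    then show ?thesis
      by (simp add: has_field_derivative_iff zero [OF that])
  qed
  have "hessian f w $ i $ j = (\<Sum>r<m. N r i w * N r j w)" for w i j
  proof (rule tendsto_unique [of "at (0::real)"])
    show "((\<lambda>s. \<Sum>r<m. M r i (s *\<^sub>R w) / s * (M r j (s *\<^sub>R w) / s))
        \<longlongrightarrow> (\<Sum>r<m. N r i w * N r j w)) (at 0)"
      by (intro tendsto_sum tendsto_mult quotient) auto
    have "(\<Sum>r<m. M r i (s *\<^sub>R w) / s * (M r j (s *\<^sub>R w) / s)) = hessian f w $ i $ j"
      if "s \<noteq> 0" for s
    proof -
      have "(\<Sum>r<m. M r i (s *\<^sub>R w) / s * (M r j (s *\<^sub>R w) / s))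
          = hessian f (s *\<^sub>R w) $ i $ j / s\<^sup>2"
        by (simp add: fac sum_divide_distrib power2_eq_square)
      then show ?thesis
        using that by (simp add: hom)
    qed
    then show "((\<lambda>s. \<Sum>r<m. M r i (s *\<^sub>R w) / s * (M r j (s *\<^sub>R w) / s))
        \<longlongrightarrow> hessian f w $ i $ j) (at 0)"
      by (intro tendsto_eventually) (auto simp: eventually_at_filter)
  qed simp
  then show ?thesis
    using that [of m N] has_derivative_linear [OF deriv] by blast
qed

text \<open>
  Polarization turns the factorization, an identity of quadratic forms in the point, into
  statements about the coefficient vectors of the linear maps \<open>N r i\<close>.
\<close>

lemma factor_polarization:
  fixes N :: "nat \<Rightarrow> 'i \<Rightarrow> 'a::real_vector \<Rightarrow> real"
  assumes "\<And>r i. r < m \<Longrightarrow> linear (N r i)" and "\<And>w. H w = (\<Sum>r<m. N r i w * N r j w)"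
  shows "(\<Sum>r<m. N r i u * N r j v + N r i v * N r j u) = H (u + v) - H u - H v"
proof -
  have "H (u + v) - H u - H v
      = (\<Sum>r<m. N r i (u + v) * N r j (u + v) - N r i u * N r j u - N r i v * N r j v)"
    by (simp add: assms(2) sum_subtractf)
  also have "\<dots> = (\<Sum>r<m. N r i u * N r j v + N r i v * N r j u)"
    by (intro sum.cong refl) (simp add: assms(1) linear_add algebra_simps)
  finally show ?thesis by simp
qed


section \<open>The Hessian\<close>

text \<open>
  The residues modulo 3 are written \<open>0, 1, 2\<close>, so that sums over the index type and cyclic
  successors can be evaluated by rewriting.
\<close>

lemma residue_simps:
  "(3::3) = 0" "(4::3) = 1" "(0::3) \<noteq> 1" "(0::3) \<noteq> 2" "(1::3) \<noteq> 2" "(1::3) \<noteq> 0" "(2::3) \<noteq> 0"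
  "(2::3) \<noteq> 1"
  by simp_all

lemma sum_residues: "sum f (UNIV::3 set) = f 0 + f 1 + f 2" for f :: "3 \<Rightarrow> real"
  by (simp add: sum_3 residue_simps)

lemma all_residues: "(\<forall>i::3. P i) \<longleftrightarrow> P 0 \<and> P 1 \<and> P 2"
  by (auto simp add: forall_3 residue_simps)

text \<open>
  The coefficients of \<open>B\<^sup>*\<close>, symmetrized in \<open>i, j\<close> and in \<open>k, l\<close>. They are also symmetric under
  exchanging \<open>x\<close> and \<open>y\<close>.
\<close>

definition b :: "3 \<Rightarrow> 3 \<Rightarrow> 3 \<Rightarrow> 3 \<Rightarrow> real" where
  "b i j k l =
    (if i = j \<and> k = l then if i = k then 2 else 3
     else if i = j \<and> (k = i \<and> l = i + 1 \<or> l = i \<and> k = i + 1) then -1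
     else if k = l \<and> (i = k \<and> j = k + 1 \<or> j = k \<and> i = k + 1) then -1
     else 0)"

lemma b_commute: "b j i k l = b i j k l" "b i j l k = b i j k l"
  by (auto simp: b_def)

lemma partial_deriv_eqI:
  assumes "((\<lambda>t. f (w + t *\<^sub>R axis i 1)) has_real_derivative d) (at 0)"
  shows "partial_deriv i f w = d"
  unfolding partial_deriv_def using assms by (rule DERIV_imp_deriv)

lemma partial_deriv_x:
  "partial_deriv (Inl a) f_poly = (\<lambda>w. 4 * (w $ Inl a)^3
    + 0.2 * (\<Sum>j\<in>UNIV. \<Sum>k\<in>UNIV. \<Sum>l\<in>UNIV. b a j k l * w $ Inl j * w $ Inr k * w $ Inr l))"
  (is "?P a")
proof -
  have "\<forall>a. ?P a"
    unfolding all_residues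
    by (intro conjI ext partial_deriv_eqI;
        auto simp: f_poly_def f_sep_def B_star_def x_part_def y_part_def sum_residues b_def
          axis_def residue_simps intro!: derivative_eq_intros;
        simp add: algebra_simps power2_eq_square power3_eq_cube)
  then show ?thesis ..
qed

lemma partial_deriv_y:
  "partial_deriv (Inr a) f_poly = (\<lambda>w. 4 * (w $ Inr a)^3
    + 0.2 * (\<Sum>i\<in>UNIV. \<Sum>j\<in>UNIV. \<Sum>l\<in>UNIV. b i j a l * w $ Inl i * w $ Inl j * w $ Inr l))"
  (is "?P a")
proof -
  have "\<forall>a. ?P a"
    unfolding all_residues
    by (intro conjI ext partial_deriv_eqI;
        auto simp: f_poly_def f_sep_def B_star_def x_part_def y_part_def sum_residues b_def
          axis_def residue_simps intro!: derivative_eq_intros;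
        simp add: algebra_simps power2_eq_square power3_eq_cube)
  then show ?thesis ..
qed

lemma hessian_xx:
  "hessian f_poly w $ Inl i $ Inl j = (if i = j then 12 * (w $ Inl i)\<^sup>2 else 0)
    + 0.2 * (\<Sum>k\<in>UNIV. \<Sum>l\<in>UNIV. b i j k l * w $ Inr k * w $ Inr l)"
  (is "_ = ?h i j")
proof -
  have "\<forall>i j. partial_deriv (Inl i) (partial_deriv (Inl j) f_poly) w = ?h i j"
    unfolding all_residues partial_deriv_x
    by (intro conjI partial_deriv_eqI;
        auto simp: sum_residues b_def axis_def residue_simps intro!: derivative_eq_intros)
  then show ?thesis by (simp add: hessian_def)
qed

lemma hessian_yy:
  "hessian f_poly w $ Inr k $ Inr l = (if k = l then 12 * (w $ Inr k)\<^sup>2 else 0)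
    + 0.2 * (\<Sum>i\<in>UNIV. \<Sum>j\<in>UNIV. b i j k l * w $ Inl i * w $ Inl j)"
  (is "_ = ?h k l")
proof -
  have "\<forall>k l. partial_deriv (Inr k) (partial_deriv (Inr l) f_poly) w = ?h k l"
    unfolding all_residues partial_deriv_y
    by (intro conjI partial_deriv_eqI;
        auto simp: sum_residues b_def axis_def residue_simps intro!: derivative_eq_intros)
  then show ?thesis by (simp add: hessian_def)
qed

lemma hessian_xy:
  "hessian f_poly w $ Inl i $ Inr k
    = 0.4 * (\<Sum>j\<in>UNIV. \<Sum>l\<in>UNIV. b i j k l * w $ Inl j * w $ Inr l)"
  (is "_ = ?h i k")
proof -
  have "\<forall>i k. partial_deriv (Inl i) (partial_deriv (Inr k) f_poly) w = ?h i k"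
    unfolding all_residues partial_deriv_y
    by (intro conjI partial_deriv_eqI;
        auto simp: sum_residues b_def axis_def residue_simps algebra_simps
          intro!: derivative_eq_intros)
  then show ?thesis by (simp add: hessian_def)
qed

lemma hessian_yx:
  "hessian f_poly w $ Inr k $ Inl i
    = 0.4 * (\<Sum>j\<in>UNIV. \<Sum>l\<in>UNIV. b i j k l * w $ Inl j * w $ Inr l)"
  (is "_ = ?h i k")
proof -
  have "\<forall>i k. partial_deriv (Inr k) (partial_deriv (Inl i) f_poly) w = ?h i k"
    unfolding all_residues partial_deriv_x
    by (intro conjI partial_deriv_eqI;
        auto simp: sum_residues b_def axis_def residue_simps algebra_simps
          intro!: derivative_eq_intros)
  then show ?thesis by (simp add: hessian_def)
qed

lemma hessian_homogeneous: "hessian f_poly (s *\<^sub>R w) = s\<^sup>2 *\<^sub>R hessian f_poly w"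
proof -
  have "hessian f_poly (s *\<^sub>R w) $ i $ j = s\<^sup>2 * hessian f_poly w $ i $ j" for i j
    by (cases i; cases j)
      (simp_all add: hessian_xx hessian_xy hessian_yx hessian_yy sum_distrib_left
        power_mult_distrib algebra_simps power2_eq_square)
  then show ?thesis
    by (simp add: vec_eq_iff)
qed


section \<open>The certificate\<close>

text \<open>
  Only this combination of products of coefficient vectors within one family is determined by
  the Hessian: the bilinear monomials satisfy \<open>z\<^sub>i y\<^sub>k \<cdot> z\<^sub>j y\<^sub>l = z\<^sub>i y\<^sub>l \<cdot> z\<^sub>j y\<^sub>k\<close>,
  where \<open>(z,t)\<close> is the direction in which the Hessian form at \<open>(x,y)\<close> is evaluated.
\<close>

definition exchange_sum :: "(3 \<Rightarrow> 3 \<Rightarrow> real) \<Rightarrow> 3 \<Rightarrow> 3 \<Rightarrow> 3 \<Rightarrow> 3 \<Rightarrow> real"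
  where "exchange_sum p i j k l = p i k * p j l + p i l * p j k"

definition neighbours :: "(3 \<Rightarrow> 3 \<Rightarrow> real) \<Rightarrow> 3 \<Rightarrow> real"
  where "neighbours p i = p i (i + 1) + p (i + 1) i"

text \<open>
  The next two functions collect the certificate's terms within one family and between the two
  families.
\<close>

definition pure_part :: "(3 \<Rightarrow> 3 \<Rightarrow> 3 \<Rightarrow> 3 \<Rightarrow> real) \<Rightarrow> real" where
  "pure_part R = (\<Sum>i\<in>UNIV.
      32 * R i i i i
    + 8 * R i i (i+1) (i+1) + 8 * R (i+1) (i+1) i i
    + 32 * R i (i+1) i (i+1)
    + 4 * R i (i+1) (i+1) (i+1) + 4 * R (i+1) (i+1) i (i+1)
    + 8 * R i (i+1) i (i+2) + 8 * R i (i+2) i (i+1)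
    + 4 * R (i+2) (i+1) i i + 4 * R i i (i+2) (i+1))"

definition mixed_part :: "(3 \<Rightarrow> 3 \<Rightarrow> real) \<Rightarrow> (3 \<Rightarrow> 3 \<Rightarrow> real) \<Rightarrow> real" where
  "mixed_part p q = (\<Sum>i\<in>UNIV.
      64 * (p i i * neighbours q i)
    + 16 * (p i i * q (i+1) (i+1))
    + 4 * (neighbours p i * neighbours q (i+1))
    + 16 * (p i i * neighbours q (i+1))
    + 16 * (neighbours p i * q (i+1) (i+1)))"

text \<open>
  The weights are one member of a one-parameter family. Scale the neighbour terms in \<open>g\<close> and \<open>h\<close> by \<open>r\<close>
  relative to the diagonal term (here \<open>r = 1/2\<close>), and weight the three \<open>g\<^sub>i\<close> by the circulant matrix
  with diagonal entries 1 and off-diagonal entries \<open>\<rho>\<close>, and the \<open>h\<^sub>i\<close> by the one with \<open>\<sigma>\<close>.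
  The equal diagonals make the products of \<open>p i k\<close> with \<open>q i k\<close>, which the Hessian does not
  determine, cancel. The remaining terms group into exchange sums if \<open>\<rho> + \<sigma> = 2 r\<^sup>2\<close> and
  \<open>\<rho> - \<sigma> = r (\<rho> + \<sigma>)\<close>. The coefficients of \<open>B\<^sup>*\<close> then give a positive multiple of
  \<open>8 - 32 r + 24 r\<^sup>2\<close>, negative for \<open>1/3 < r < 1\<close>. With \<open>r = 1/2\<close>, \<open>\<rho> = 3/8\<close> and \<open>\<sigma> = 1/8\<close>
  both circulants are positive definite; 8 times them are \<open>5 I + 3 J\<close> and \<open>7 I + J\<close>, where \<open>I\<close> is
  the identity and \<open>J\<close> the all-ones matrix.
\<close>

lemma certificate_identity:
  fixes p q :: "3 \<Rightarrow> 3 \<Rightarrow> real"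
  defines "g \<equiv> \<lambda>i. 2 * (p i i + q i i) + (neighbours p i + neighbours q i)"
    and "h \<equiv> \<lambda>i. 2 * (p i i - q i i) - (neighbours p i - neighbours q i)"
  shows "5 * (\<Sum>i\<in>UNIV. (g i)\<^sup>2) + 3 * (\<Sum>i\<in>UNIV. g i)\<^sup>2
      + 7 * (\<Sum>i\<in>UNIV. (h i)\<^sup>2) + (\<Sum>i\<in>UNIV. h i)\<^sup>2
    = pure_part (exchange_sum p) + pure_part (exchange_sum q) + mixed_part p q + mixed_part q p"
  unfolding pure_part_def exchange_sum_def mixed_part_def g_def h_def neighbours_def sum_residues
  by (simp add: residue_simps) algebra

text \<open>
  Here \<open>P r i k\<close> and \<open>Q r i k\<close> are the \<open>r\<close>-th entries of the vectors called \<open>P\<^sub>i\<^sub>k\<close> and \<open>Q\<^sub>i\<^sub>k\<close> above,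
  and the sums over \<open>r\<close> are inner products. The hypotheses express that, with
  \<open>p = \<Sum> z\<^sub>i y\<^sub>k P\<^sub>i\<^sub>k\<close> and \<open>q = \<Sum> x\<^sub>i t\<^sub>k Q\<^sub>i\<^sub>k\<close>, the square of \<open>p + q\<close> reproduces \<open>c\<close> times the
  second-derivative form of \<open>B\<^sup>*\<close> at \<open>(x,y)\<close> in direction \<open>(z,t)\<close>, up to multiples of the
  monomials \<open>x\<^sub>i z\<^sub>i y\<^sub>k t\<^sub>k\<close>. Summing the certificate over \<open>r\<close> gives \<open>0 \<le> 2 \<cdot> 1344 c - 2 \<cdot> 1536 c\<close>.
\<close>

lemma no_gram_vectors:
  fixes P Q :: "nat \<Rightarrow> 3 \<Rightarrow> 3 \<Rightarrow> real"
  assumes PP: "\<And>i j k l. (\<Sum>r<m. exchange_sum (P r) i j k l) = 4 * c * b i j k l"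
    and QQ: "\<And>i j k l. (\<Sum>r<m. exchange_sum (Q r) i j k l) = 4 * c * b i j k l"
    and PQ: "\<And>i j k l. i \<noteq> j \<or> k \<noteq> l \<Longrightarrow> (\<Sum>r<m. P r i l * Q r j k) = 4 * c * b i j k l"
  shows "c \<le> 0"
proof -
  have QP: "(\<Sum>r<m. Q r j k * P r i l) = 4 * c * b i j k l" if "i \<noteq> j \<or> k \<noteq> l" for i j k l
    using PQ [OF that] by (simp add: mult.commute)
  have pure_sum: "(\<Sum>r<m. pure_part (exchange_sum (F r)))
      = pure_part (\<lambda>i j k l. \<Sum>r<m. exchange_sum (F r) i j k l)"
    for F :: "nat \<Rightarrow> 3 \<Rightarrow> 3 \<Rightarrow> real"
    unfolding pure_part_def sum_residues by (simp add: sum.distrib sum_distrib_left)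
  have pure: "pure_part (\<lambda>i j k l. 4 * c * b i j k l) = 1344 * c"
    by (simp add: pure_part_def sum_residues b_def residue_simps)
  have mixed: "(\<Sum>r<m. mixed_part (P r) (Q r)) = -1536 * c"
      "(\<Sum>r<m. mixed_part (Q r) (P r)) = -1536 * c"
    unfolding mixed_part_def neighbours_def sum_residues
    by (simp_all add: distrib_left distrib_right sum.distrib flip: sum_distrib_left)
      (simp_all add: PQ QP residue_simps b_def)
  have "0 \<le> (\<Sum>r<m. pure_part (exchange_sum (P r)) + pure_part (exchange_sum (Q r))
      + mixed_part (P r) (Q r) + mixed_part (Q r) (P r))"
    unfolding certificate_identity [symmetric]
    by (intro sum_nonneg add_nonneg_nonneg mult_nonneg_nonneg) auto
  also have "\<dots> = -384 * c"
    by (simp add: sum.distrib pure_sum PP QQ pure mixed)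
  finally show ?thesis by simp
qed


section \<open>Failure of sos-convexity\<close>

theorem theorem3p2: "\<not> sos_convex f_poly"
proof
  assume "sos_convex f_poly"
  then obtain m N where lin: "\<And>r i. r < (m::nat) \<Longrightarrow> linear (N r i)"
    and fac: "\<And>w i j. hessian f_poly w $ i $ j = (\<Sum>r<m. N r i w * N r j w)"
    using sos_convex_linear_factor [OF _ hessian_homogeneous] by blast
  have polar: "(\<Sum>r<m. N r i u * N r j v + N r i v * N r j u)
      = hessian f_poly (u + v) $ i $ j - hessian f_poly u $ i $ j - hessian f_poly v $ i $ j"
    for i j u v
    using lin fac by (rule factor_polarization)
  define ex ey :: "3 \<Rightarrow> real^(3 + 3)"
    where "ex j = axis (Inl j) 1" and "ey l = axis (Inr l) 1" for j l
  have ex_nth: "ex j $ Inl i = (if i = j then 1 else 0)" "ex j $ Inr k = 0" for i j k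
    by (auto simp: ex_def axis_def)
  have ey_nth: "ey l $ Inr k = (if k = l then 1 else 0)" "ey l $ Inl i = 0" for i k l
    by (auto simp: ey_def axis_def)
  have vanish: "N r i w = 0" if "hessian f_poly w $ i $ i = 0" "r < m" for r i w
    using that unfolding fac by (subst (asm) sum_nonneg_eq_0_iff) auto
  have Nx: "N r (Inl i) (ex j) = 0" if "i \<noteq> j" "r < m" for r i j
    using that by (intro vanish) (auto simp: hessian_xx ex_nth)
  have Ny: "N r (Inr k) (ey l) = 0" if "k \<noteq> l" "r < m" for r k l
    using that by (intro vanish) (auto simp: hessian_yy ey_nth)
  define P where "P r i k = N r (Inl i) (ey k)" for r i k
  define Q where "Q r i k = N r (Inr k) (ex i)" for r i k
  have "(1/10::real) \<le> 0"
  proof (rule no_gram_vectors)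
    fix i j k l :: 3
    have "\<forall>k l. hessian f_poly (ey k + ey l) $ Inl i $ Inl j
        - hessian f_poly (ey k) $ Inl i $ Inl j - hessian f_poly (ey l) $ Inl i $ Inl j
        = 0.2 * (b i j k l + b i j l k)"
      unfolding all_residues by (simp add: hessian_xx ey_nth sum_residues residue_simps field_simps)
    then show "(\<Sum>r<m. exchange_sum (P r) i j k l) = 4 * (1/10) * b i j k l"
      using polar [of "Inl i" "ey k" "Inl j" "ey l"]
      by (simp add: exchange_sum_def P_def b_commute)
    have "\<forall>i j. hessian f_poly (ex i + ex j) $ Inr k $ Inr l
        - hessian f_poly (ex i) $ Inr k $ Inr l - hessian f_poly (ex j) $ Inr k $ Inr l
        = 0.2 * (b i j k l + b j i k l)"
      unfolding all_residues by (simp add: hessian_yy ex_nth sum_residues residue_simps field_simps)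
    then show "(\<Sum>r<m. exchange_sum (Q r) i j k l) = 4 * (1/10) * b i j k l"
      using polar [of "Inr k" "ex i" "Inr l" "ex j"]
      by (simp add: exchange_sum_def Q_def b_commute mult.commute)
    have mixed: "\<forall>j l. hessian f_poly (ex j + ey l) $ Inl i $ Inr k
        - hessian f_poly (ex j) $ Inl i $ Inr k - hessian f_poly (ey l) $ Inl i $ Inr k
        = 0.4 * b i j k l"
      unfolding all_residues by (simp add: hessian_xy ex_nth ey_nth sum_residues residue_simps field_simps)
    assume "i \<noteq> j \<or> k \<noteq> l"
    \<comment> \<open>One factor of the other product in the polarized identity vanishes.\<close>
    then have "(\<Sum>r<m. P r i l * Q r j k)
        = (\<Sum>r<m. N r (Inl i) (ex j) * N r (Inr k) (ey l) + N r (Inl i) (ey l) * N r (Inr k) (ex j))"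
      by (intro sum.cong) (auto simp: P_def Q_def Nx Ny)
    then show "(\<Sum>r<m. P r i l * Q r j k) = 4 * (1/10) * b i j k l"
      using mixed by (simp add: polar)
  qed
  then show False by simp
qed

end
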